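(* For all integers $r,s\ge 0$ and $k\ge 1$, one has the identity of operators on $T^{r+k+s}$ $$\mathcal P_{q\text{-sym}}^{\,r+k+s}\,(I_r\otimes \mathcal P_{q\text{-sym}}^{k}\otimes I_s)=\mathcal P_{q\text{-sym}}^{\,r+k+s}.$$
   Context: Setting. $V$ is a complex vector space with basis $X_1,\dots,X_N$; $T=T(V)=\bigoplus_{r\ge 0}T^r$, $T^r=V^{\otimes r}$; the sign $\otimes$ is often omitted. Fix $q\in\mathbb C^*$ and, for $N\ge i>j\ge 1$, nonzero complex numbers of the form $b_{ij}=q^{\alpha_{ij}}$ and elements $p_{ij}\in\mathrm{Span}\{X_aX_b\mid 1\le a,b\le i-1\}\subset T^2$. $I_R\subset T$ is the two-sided ideal generated by all $X_iX_j-b_{ij}X_jX_i-p_{ij}$ ($i>j$), and $\mathcal A=T/I_R$. Order. For a monomial $X=X_{i_1}\cdots X_{i_r}\in T^r$ put $\ell(X)=(n_1,\dots,n_N)$, $n_i=\#\{s\mid i_s=i\}$. On $\{0,\dots,r\}^N$ use the lexicographic order $\le_l$ in which the last coordinate is most significant (so $(0,\dots,0,r)$ is the biggest). For monomials $u,u'\in T^r$, $u'\le_l u$ means $\ell(u')\le_l\ell(u)$; the order of a nonzero element of $T^r$ is the largest $\ell$ of the monomials occurring in it, and elements are compared via their orders. Standing assumption (EA): every nonzero homogeneous $u\in I_R$ lies in the span of the elements $a(X_iX_j-b_{ij}X_jX_i-p_{ij})b$ with $i>j$, $a,b$ monomials in $T$, and $aX_iX_jb\le_l u$. Operators. $S:V\otimes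 V\to V\otimes V$ is the linear map with $S(X_iX_j)=b_{ij}X_jX_i+p_{ij}$ and $S(X_jX_i)=b_{ij}^{-1}(X_iX_j-p_{ij})$ for $i>j$, and $S(X_iX_i)=X_iX_i$. On $T^n$, $\sigma_i$ ($1\le i\le n-1$) is $S$ applied in tensor positions $i,i+1$. For each $\sigma\in S_n$ (symmetric group) choose an expression $\sigma=s_{i_1}\cdots s_{i_m}$ as a product of elementary transpositions $s_j=(j\ j{+}1)$ and put $\widehat\sigma=\sigma_{i_1}\cdots\sigma_{i_m}$; put $P=\frac1{n!}\sum_{\sigma\in S_n}\widehat\sigma$ on $T^n$. Then $\mathcal P_{q\text{-sym}}=\lim_{M\to\infty}P^M$ (for each $u\in T^n$ the sequence $P^M(u)$ is eventually constant, and the limit does not depend on the choices of expressions). $\mathcal P^n_{q\text{-sym}}$ is its restriction to $T^n$. $I_r\otimes\mathcal P_{q\text{-sym}}^k\otimes I_s$ is the operator on $T^{r+k+s}=T^r\otimes T^k\otimes T^s$ acting as $\mathcal P_{q\text{-sym}}^k$ on the middle factor and as the identity on the other two. *)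

theory Defs
  imports
    "HOL-Analysis.Analysis"
    "HOL-Library.Poly_Mapping"
    "HOL-Combinatorics.Permutations"
begin

section \<open>The tensor algebra\<close>

text \<open>
  The index set of the basis is a finite linearly ordered type \<open>'n\<close>, in order isomorphism with
  \<open>{1..N}\<close>, \<open>N = CARD('n)\<close>.  In the basis of monomials, the tensor algebra of \<open>V\<close> is the monoid
  algebra of the free monoid of words over \<open>'n\<close>; with words as an additive (noncommutative) monoid,
  the tensor product is the convolution product of \<open>Poly_Mapping\<close>.
\<close>

instantiation list :: (type) monoid_add
begin

definition zero_list :: "'a list" where "zero_list = []"

definition plus_list :: "'a list \<Rightarrow> 'a list \<Rightarrow> 'a list" where "plus_list = (@)"

instance by standard (simp_all add: zero_list_def plus_list_def)

end

type_synonym 'n tens = "'n list \<Rightarrow>\<^sub>0 complex"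

definition monomial :: "'n list \<Rightarrow> 'n tens" where
  "monomial w = Poly_Mapping.single w 1"

definition scale :: "complex \<Rightarrow> 'n tens \<Rightarrow> 'n tens" where
  "scale c u = Poly_Mapping.map (\<lambda>x. c * x) u"

lemma lookup_scale: "Poly_Mapping.lookup (scale c u) w = c * Poly_Mapping.lookup u w"
  by (simp add: scale_def Poly_Mapping.map.rep_eq when_def)

global_interpretation tens: vector_space scale
  by unfold_locales
    (simp_all add: poly_mapping_eq_iff fun_eq_iff lookup_scale lookup_add algebra_simps)

definition Tn :: "nat \<Rightarrow> 'n tens set" where
  "Tn r = {u. \<forall>w \<in> Poly_Mapping.keys u. length w = r}"

definition lin_ext :: "('n list \<Rightarrow> 'n tens) \<Rightarrow> 'n tens \<Rightarrow> 'n tens" where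
  "lin_ext f u = (\<Sum>w \<in> Poly_Mapping.keys u. scale (Poly_Mapping.lookup u w) (f w))"

text \<open>
  \<open>id_tensor r k F\<close> is the operator \<open>I\<^sub>r \<otimes> F \<otimes> I\<^sub>s\<close> for \<open>F\<close> acting on the component of degree \<open>k\<close>; the
  value of \<open>s\<close> is read off from the degree \<open>r + k + s\<close> of the argument.
\<close>

definition id_tensor :: "nat \<Rightarrow> nat \<Rightarrow> ('n tens \<Rightarrow> 'n tens) \<Rightarrow> 'n tens \<Rightarrow> 'n tens" where
  "id_tensor r k F =
     lin_ext (\<lambda>w. monomial (take r w) * F (monomial (take k (drop r w))) * monomial (drop (r + k) w))"


section \<open>The relations and the ideal\<close>

definition rel ::
  "('n \<Rightarrow> 'n \<Rightarrow> complex) \<Rightarrow> ('n \<Rightarrow> 'n \<Rightarrow> 'n tens) \<Rightarrow> 'n \<Rightarrow> 'n \<Rightarrow> 'n tens" where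
  "rel b p i j = monomial [i, j] - scale (b i j) (monomial [j, i]) - p i j"

definition two_sided_ideal :: "'a::ring_1 set \<Rightarrow> bool" where
  "two_sided_ideal I \<longleftrightarrow> 0 \<in> I \<and> (\<forall>x\<in>I. \<forall>y\<in>I. x + y \<in> I) \<and> (\<forall>x\<in>I. \<forall>a. a * x \<in> I \<and> x * a \<in> I)"

definition ideal_R ::
  "('n::linorder \<Rightarrow> 'n \<Rightarrow> complex) \<Rightarrow> ('n \<Rightarrow> 'n \<Rightarrow> 'n tens) \<Rightarrow> 'n tens set" where
  "ideal_R b p = two_sided_ideal hull {rel b p i j | i j. j < i}"


section \<open>The order and the standing assumption\<close>

text \<open>
  The multidegree \<open>\<ell>\<close> of the monomial with word \<open>w\<close> is \<open>count_list w\<close>.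
\<close>

definition lex_le :: "('n::linorder \<Rightarrow> nat) \<Rightarrow> ('n \<Rightarrow> nat) \<Rightarrow> bool" where
  "lex_le m m' \<longleftrightarrow> m = m' \<or> (\<exists>i. m i < m' i \<and> (\<forall>j>i. m j = m' j))"

definition tord :: "'n::{finite,linorder} tens \<Rightarrow> 'n \<Rightarrow> nat" where
  "tord u = (THE m. m \<in> count_list ` Poly_Mapping.keys u \<and>
                    (\<forall>w \<in> Poly_Mapping.keys u. lex_le (count_list w) m))"

text \<open>
  The order compares monomials of equal degree only, whence the condition on the length.
\<close>

definition EA ::
  "('n::{finite,linorder} \<Rightarrow> 'n \<Rightarrow> complex) \<Rightarrow> ('n \<Rightarrow> 'n \<Rightarrow> 'n tens) \<Rightarrow> bool" where
  "EA b p \<longleftrightarrow> (\<forall>r. \<forall>u \<in> ideal_R b p \<inter> Tn r. u \<noteq> 0 \<longrightarrow>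
     u \<in> tens.span {monomial v * rel b p i j * monomial w | v w i j.
           j < i \<and> length (v @ [i, j] @ w) = r \<and> lex_le (count_list (v @ [i, j] @ w)) (tord u)})"


section \<open>The operators\<close>

definition S_word ::
  "('n::linorder \<Rightarrow> 'n \<Rightarrow> complex) \<Rightarrow> ('n \<Rightarrow> 'n \<Rightarrow> 'n tens) \<Rightarrow> 'n \<Rightarrow> 'n \<Rightarrow> 'n tens" where
  "S_word b p i j =
     (if j < i then scale (b i j) (monomial [j, i]) + p i j
      else if i < j then scale (inverse (b j i)) (monomial [j, i] - p j i)
      else monomial [i, i])"

text \<open>Only the values of \<open>S_op\<close> on \<open>V \<otimes> V\<close>, that is on \<open>Tn 2\<close>, are relevant.\<close>

definition S_op ::
  "('n::linorder \<Rightarrow> 'n \<Rightarrow> complex) \<Rightarrow> ('n \<Rightarrow> 'n \<Rightarrow> 'n tens) \<Rightarrow> 'n tens \<Rightarrow> 'n tens" where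
  "S_op b p = lin_ext (\<lambda>w. S_word b p (w ! 0) (w ! 1))"

definition sigma_op ::
  "('n::linorder \<Rightarrow> 'n \<Rightarrow> complex) \<Rightarrow> ('n \<Rightarrow> 'n \<Rightarrow> 'n tens) \<Rightarrow> nat \<Rightarrow> 'n tens \<Rightarrow> 'n tens" where
  "sigma_op b p i = id_tensor (i - 1) 2 (S_op b p)"

text \<open>
  A choice of expressions assigns to \<open>n\<close> and \<open>\<sigma> \<in> S\<^sub>n\<close> the list \<open>[i\<^sub>1, \<dots>, i\<^sub>m]\<close> of the indices of some
  (not necessarily reduced) expression \<open>\<sigma> = s\<^bsub>i\<^sub>1\<^esub> \<cdots> s\<^bsub>i\<^sub>m\<^esub>\<close>.
\<close>

definition expression_choice :: "(nat \<Rightarrow> (nat \<Rightarrow> nat) \<Rightarrow> nat list) \<Rightarrow> bool" where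
  "expression_choice e \<longleftrightarrow> (\<forall>n \<sigma>. \<sigma> permutes {1..n} \<longrightarrow>
     set (e n \<sigma>) \<subseteq> {1..<n} \<and>
     foldr (\<lambda>j f. Transposition.transpose j (j + 1) \<circ> f) (e n \<sigma>) id = \<sigma>)"

definition hat_op ::
  "('n::linorder \<Rightarrow> 'n \<Rightarrow> complex) \<Rightarrow> ('n \<Rightarrow> 'n \<Rightarrow> 'n tens) \<Rightarrow> nat list \<Rightarrow> 'n tens \<Rightarrow> 'n tens" where
  "hat_op b p js = foldr (\<lambda>j f. sigma_op b p j \<circ> f) js id"

definition P_op ::
  "('n::linorder \<Rightarrow> 'n \<Rightarrow> complex) \<Rightarrow> ('n \<Rightarrow> 'n \<Rightarrow> 'n tens) \<Rightarrow> (nat \<Rightarrow> (nat \<Rightarrow> nat) \<Rightarrow> nat list) \<Rightarrow>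
    nat \<Rightarrow> 'n tens \<Rightarrow> 'n tens" where
  "P_op b p e n u = scale (1 / fact n) (\<Sum>\<sigma> | \<sigma> permutes {1..n}. hat_op b p (e n \<sigma>) u)"

text \<open>
  The limit is taken in the finite-dimensional space \<open>Tn n\<close>, that is coefficientwise.
\<close>

definition P_qsym ::
  "('n::linorder \<Rightarrow> 'n \<Rightarrow> complex) \<Rightarrow> ('n \<Rightarrow> 'n \<Rightarrow> 'n tens) \<Rightarrow> (nat \<Rightarrow> (nat \<Rightarrow> nat) \<Rightarrow> nat list) \<Rightarrow>
    nat \<Rightarrow> 'n tens \<Rightarrow> 'n tens" where
  "P_qsym b p e n u = (THE v. \<forall>w.
     (\<lambda>M. Poly_Mapping.lookup ((P_op b p e n ^^ M) u) w) \<longlonglongrightarrow> Poly_Mapping.lookup v w)"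

end

theory Submission
  imports Defs
begin

text \<open>
  Each \<open>\<sigma>\<^sub>i\<close> is the identity modulo the ideal \<open>I\<^sub>R\<close>, hence so are \<open>P\<close> and all its powers.  Up to terms of
  smaller order, \<open>\<sigma>\<^sub>i\<close> swaps two adjacent letters with a scalar factor, and dividing each word by the
  product of the \<open>b\<close>'s over its inversions removes this factor.  So up to smaller order \<open>P\<close> is the
  symmetrizer in the rescaled words; there the leading part of a relation is a difference of two
  words that agree up to a swap, which the symmetrizer kills.  By (EA), \<open>P\<close> lowers the order of
  every element of \<open>I\<^sub>R \<inter> T\<^sup>n\<close> and is therefore locally nilpotent there.  Consequently \<open>P\<^sup>M u\<close> is eventually
  constant, its limit is congruent to \<open>u\<close> modulo \<open>I\<^sub>R\<close> and depends only on the class of \<open>u\<close>, whereas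
  \<open>I\<^sub>r \<otimes> \<P>\<^sup>k \<otimes> I\<^sub>s\<close> does not change the class.
\<close>

section \<open>Linear maps on the tensor algebra\<close>

global_interpretation tens_pair: vector_space_pair scale scale ..

lemma tens_eq_sum_singles:
  "u = (\<Sum>w\<in>Poly_Mapping.keys u. Poly_Mapping.single w (Poly_Mapping.lookup u w))"
  by (rule poly_mapping_eqI)
    (auto simp: lookup_sum lookup_single when_def in_keys_iff if_distrib cong: if_cong)

lemma scale_single: "scale c (Poly_Mapping.single w a) = Poly_Mapping.single w (c * a)"
  by (rule poly_mapping_eqI) (simp add: lookup_scale lookup_single when_def)

lemma scale_eq_mult: "scale c u = Poly_Mapping.single 0 c * u"
proof -
  \<comment> \<open>Stated for an arbitrary index set and arbitrary coefficients, so that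
    \<open>tens_eq_sum_singles\<close> only has to be folded back at the end. Rewriting
    \<open>u\<close> with it directly would loop, since \<open>u\<close> recurs on its right-hand
    side.\<close>
  have "scale c (\<Sum>w\<in>A. Poly_Mapping.single w (f w))
      = Poly_Mapping.single 0 c * (\<Sum>w\<in>A. Poly_Mapping.single w (f w))"
    for A and f :: "'a list \<Rightarrow> complex"
    by (simp add: tens.scale_sum_right sum_distrib_left scale_single mult_single)
  from this[where A = "Poly_Mapping.keys u" and f = "Poly_Mapping.lookup u"] show ?thesis
    by (simp only: tens_eq_sum_singles[symmetric])
qed

text \<open>Scalars sit on the empty word, the unit of concatenation, and are therefore central
  although the algebra is not commutative. This lets scalars pass through a left factor.\<close>

lemma single_zero_commute: "Poly_Mapping.single 0 c * u = u * Poly_Mapping.single 0 c"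
  for u :: "'n tens"
proof -
  have "Poly_Mapping.single 0 c * (\<Sum>w\<in>A. Poly_Mapping.single w (f w))
      = (\<Sum>w\<in>A. Poly_Mapping.single w (f w)) * Poly_Mapping.single 0 c"
    for A and f :: "'n list \<Rightarrow> complex"
    by (simp add: sum_distrib_left sum_distrib_right mult_single mult.commute)
  from this[where A = "Poly_Mapping.keys u" and f = "Poly_Mapping.lookup u"] show ?thesis
    by (simp only: tens_eq_sum_singles[symmetric])
qed

lemma scale_mult_left: "scale c u * v = scale c (u * v)"
  by (simp add: scale_eq_mult mult.assoc)

lemma scale_mult_right: "u * scale c v = scale c (u * v)"
  by (simp only: scale_eq_mult single_zero_commute[of c u] flip: mult.assoc)

lemma linear_sandwich: "Vector_Spaces.linear scale scale (\<lambda>u :: 'n tens. x * u * y)"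
  by unfold_locales (simp_all add: scale_mult_left scale_mult_right distrib_left distrib_right)

lemma monomial_mult: "monomial v * monomial w = monomial (v @ w)"
  by (simp add: monomial_def mult_single plus_list_def)

text \<open>Coefficients outside the support vanish. A common index set is what makes additivity
  provable, as the support of a sum can shrink by cancellation.\<close>

lemma lin_ext_superset:
  assumes "finite A" "Poly_Mapping.keys u \<subseteq> A"
  shows "lin_ext f u = (\<Sum>w\<in>A. scale (Poly_Mapping.lookup u w) (f w))"
  unfolding lin_ext_def
  by (rule sum.mono_neutral_left) (use assms in \<open>auto simp: in_keys_iff\<close>)

lemma linear_lin_ext: "Vector_Spaces.linear scale scale (lin_ext f)"
proof unfold_locales
  fix u v :: "'a tens"
  let ?A = "Poly_Mapping.keys u \<union> Poly_Mapping.keys v"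
  have "lin_ext f (u + v) = (\<Sum>w\<in>?A. scale (Poly_Mapping.lookup (u + v) w) (f w))"
    by (rule lin_ext_superset) (use Poly_Mapping.keys_add[of u v] in auto)
  also have "\<dots> = lin_ext f u + lin_ext f v"
    by (simp add: lin_ext_superset[of ?A] lookup_add tens.scale_left_distrib sum.distrib)
  finally show "lin_ext f (u + v) = lin_ext f u + lin_ext f v" .
next
  fix c u
  have "lin_ext f (scale c u)
      = (\<Sum>w\<in>Poly_Mapping.keys u. scale (Poly_Mapping.lookup (scale c u) w) (f w))"
    by (rule lin_ext_superset) (auto simp: in_keys_iff lookup_scale)
  then show "lin_ext f (scale c u) = scale c (lin_ext f u)"
    by (simp add: lin_ext_def lookup_scale tens.scale_sum_right)
qed

lemma lin_ext_monomial: "lin_ext f (monomial w) = f w"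
  by (simp add: lin_ext_def monomial_def)

lemma linear_id_tensor: "Vector_Spaces.linear scale scale (id_tensor r k F)"
  unfolding id_tensor_def by (rule linear_lin_ext)

lemma id_tensor_monomial:
  assumes "length v = r" "length w = k"
  shows "id_tensor r k F (monomial (v @ w @ x)) = monomial v * F (monomial w) * monomial x"
  using assms by (simp add: id_tensor_def lin_ext_monomial)

text \<open>Described by supports rather than as a linear span, so that inclusions and membership of
  words reduce to sets of words.\<close>

definition words_span :: "'n list set \<Rightarrow> 'n tens set" where
  "words_span A = {u. Poly_Mapping.keys u \<subseteq> A}"

lemma subspace_words_span: "tens.subspace (words_span A)"
  unfolding tens.subspace_def words_span_def
proof (intro conjI ballI allI)
  fix u v :: "'a tens" and c
  assume u: "u \<in> {u. Poly_Mapping.keys u \<subseteq> A}"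
  then show "scale c u \<in> {u. Poly_Mapping.keys u \<subseteq> A}"
    by (auto simp: in_keys_iff lookup_scale)
  assume "v \<in> {u. Poly_Mapping.keys u \<subseteq> A}"
  with u show "u + v \<in> {u. Poly_Mapping.keys u \<subseteq> A}"
    using Poly_Mapping.keys_add[of u v] by auto
qed auto

lemma Tn_eq_words_span: "Tn n = words_span {w. length w = n}"
  by (auto simp: Tn_def words_span_def)

lemma monomial_in_words_span: "monomial w \<in> words_span A \<longleftrightarrow> w \<in> A"
  by (simp add: monomial_def words_span_def)

lemma subspace_Tn: "tens.subspace (Tn n)"
  by (simp add: Tn_eq_words_span subspace_words_span)

lemma monomial_in_Tn: "monomial w \<in> Tn n \<longleftrightarrow> length w = n"
  by (simp add: Tn_eq_words_span monomial_in_words_span)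

lemma words_span_mono: "A \<subseteq> B \<Longrightarrow> words_span A \<subseteq> words_span B"
  by (auto simp: words_span_def)

lemma single_eq_scale_monomial: "Poly_Mapping.single w c = scale c (monomial w)"
  by (simp add: monomial_def scale_single)

lemma linear_words_span_image:
  assumes "Vector_Spaces.linear scale scale F" "tens.subspace W" "u \<in> words_span A"
    and "\<And>w. w \<in> A \<Longrightarrow> F (monomial w) \<in> W"
  shows "F u \<in> W"
proof -
  have "F (\<Sum>w\<in>B. Poly_Mapping.single w (f w)) = (\<Sum>w\<in>B. scale (f w) (F (monomial w)))" for B f
    by (simp add: single_eq_scale_monomial tens_pair.linear_sum[OF assms(1)]
        tens_pair.linear_scale[OF assms(1)])
  from this[where B = "Poly_Mapping.keys u" and f = "Poly_Mapping.lookup u"]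
  have "F u = (\<Sum>w\<in>Poly_Mapping.keys u. scale (Poly_Mapping.lookup u w) (F (monomial w)))"
    by (simp only: tens_eq_sum_singles[symmetric])
  also have "\<dots> \<in> W"
    using assms by (intro tens.subspace_sum tens.subspace_scale) (auto simp: words_span_def)
  finally show ?thesis .
qed

lemma linear_span_image:
  assumes "Vector_Spaces.linear scale scale F" "tens.subspace W" "u \<in> tens.span G"
    and "\<And>g. g \<in> G \<Longrightarrow> F g \<in> W"
  shows "F u \<in> W"
proof -
  interpret F: Vector_Spaces.linear scale scale F by fact
  have "tens.subspace (F -` W)"
    by (rule F.subspace_vimage) fact
  then show ?thesis
    using tens.span_minimal[of G "F -` W"] assms by auto
qed

section \<open>The lexicographic order\<close>

definition lex_less :: "('n::linorder \<Rightarrow> nat) \<Rightarrow> ('n \<Rightarrow> nat) \<Rightarrow> bool" where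
  "lex_less m m' \<longleftrightarrow> (\<exists>i. m i < m' i \<and> (\<forall>j>i. m j = m' j))"

lemma lex_le_iff: "lex_le m m' \<longleftrightarrow> m = m' \<or> lex_less m m'"
  by (simp add: lex_le_def lex_less_def)

lemma lex_less_irrefl: "\<not> lex_less m m"
  by (simp add: lex_less_def)

lemma lex_less_trans:
  assumes "lex_less m1 m2" "lex_less m2 m3"
  shows "lex_less m1 m3"
proof -
  obtain i where i: "m1 i < m2 i" "\<And>j. j > i \<Longrightarrow> m1 j = m2 j"
    using assms(1) by (auto simp: lex_less_def)
  obtain k where k: "m2 k < m3 k" "\<And>j. j > k \<Longrightarrow> m2 j = m3 j"
    using assms(2) by (auto simp: lex_less_def)
  \<comment> \<open>Beyond the larger of the two deciding positions all three functions agree. At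
    that position one comparison is strict and the other is strict or an equality.\<close>
  show ?thesis
    unfolding lex_less_def
  proof (intro exI[of _ "max i k"] conjI allI impI)
    show "m1 (max i k) < m3 (max i k)"
      using i k by (cases i k rule: linorder_cases) (auto simp: max_def)
  qed (use i k in auto)
qed

text \<open>The largest index at which the two functions differ decides; it exists because the
  alphabet is finite.\<close>

lemma lex_less_linear:
  fixes m m' :: "'n::{finite,linorder} \<Rightarrow> nat"
  shows "lex_less m m' \<or> m = m' \<or> lex_less m' m"
proof (cases "m = m'")
  case False
  let ?D = "{i. m i \<noteq> m' i}"
  define i where "i = Max ?D"
  have "?D \<noteq> {}" using False by auto
  then have "i \<in> ?D"
    unfolding i_def by (intro Max_in) auto
  moreover have "m j = m' j" if "j > i" for j
  proof (rule ccontr)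
    assume "m j \<noteq> m' j"
    then have "j \<le> i" unfolding i_def by (intro Max_ge) auto
    with that show False by simp
  qed
  ultimately show ?thesis
    unfolding lex_less_def by (cases "m i < m' i") (auto intro!: exI[of _ i])
qed simp

lemma lex_le_less_trans: "lex_le m1 m2 \<Longrightarrow> lex_less m2 m3 \<Longrightarrow> lex_less m1 m3"
  and lex_less_le_trans: "lex_less m1 m2 \<Longrightarrow> lex_le m2 m3 \<Longrightarrow> lex_less m1 m3"
  unfolding lex_le_iff by (blast dest: lex_less_trans)+

lemma finite_has_lex_greatest:
  fixes M :: "('n::{finite,linorder} \<Rightarrow> nat) set"
  assumes "finite M" "M \<noteq> {}"
  shows "\<exists>m\<in>M. \<forall>m'\<in>M. lex_le m' m"
  using assms
proof (induction rule: finite_ne_induct)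
  case (singleton x)
  show ?case by (simp add: lex_le_iff)
next
  case (insert x F)
  then obtain m where m: "m \<in> F" "\<forall>m'\<in>F. lex_le m' m" by blast
  show ?case
  proof (cases "lex_less m x")
    case True
    then have "\<forall>m'\<in>F. lex_le m' x"
      using m(2) lex_le_less_trans by (fastforce simp: lex_le_iff[of _ x])
    then show ?thesis by (simp add: lex_le_iff[of x x])
  next
    case False
    then have "lex_le x m"
      using lex_less_linear[of m x] by (auto simp: lex_le_iff)
    then show ?thesis using m by blast
  qed
qed

text \<open>A nonzero tensor has finite nonempty support, so a greatest multidegree exists, and
  antisymmetry makes it unique. This justifies the definite description in
  \<open>tord\<close>.\<close>

lemma tord_props:
  assumes "u \<noteq> 0"
  shows "tord u \<in> count_list ` Poly_Mapping.keys u"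
    and "w \<in> Poly_Mapping.keys u \<Longrightarrow> lex_le (count_list w) (tord u)"
proof -
  obtain m where m: "m \<in> count_list ` Poly_Mapping.keys u"
    "\<forall>w\<in>Poly_Mapping.keys u. lex_le (count_list w) m"
    using finite_has_lex_greatest[of "count_list ` Poly_Mapping.keys u"] assms by auto
  have "tord u = m"
    unfolding tord_def
  proof (rule the_equality)
    fix m' assume m': "m' \<in> count_list ` Poly_Mapping.keys u \<and>
      (\<forall>w\<in>Poly_Mapping.keys u. lex_le (count_list w) m')"
    then have "lex_le m m'" "lex_le m' m"
      using m by auto
    then show "m' = m"
      using lex_less_trans[of m m' m] lex_less_irrefl[of m] by (auto simp: lex_le_iff)
  qed (use m in auto)
  then show "tord u \<in> count_list ` Poly_Mapping.keys u"
    and "w \<in> Poly_Mapping.keys u \<Longrightarrow> lex_le (count_list w) (tord u)"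
    using m by auto
qed

text \<open>The filtration that makes "up to terms of smaller order" precise. Unlike a condition on
  \<open>tord\<close>, it includes 0, which has no order, and so gives subspaces.\<close>

definition lower :: "nat \<Rightarrow> ('n::linorder \<Rightarrow> nat) \<Rightarrow> 'n tens set" where
  "lower n m = words_span {w. length w = n \<and> lex_less (count_list w) m}"

lemma subspace_lower: "tens.subspace (lower n m)"
  by (simp add: lower_def subspace_words_span)

lemma lower_mono: "lex_le m m' \<Longrightarrow> lower n m \<subseteq> lower n m'"
  unfolding lower_def by (rule words_span_mono) (blast dest: lex_less_le_trans)

lemma lower_subset_Tn: "lower n m \<subseteq> Tn n"
  unfolding lower_def Tn_eq_words_span by (rule words_span_mono) auto

section \<open>The ideal of relations\<close>

text \<open>Two-sided ideals are closed under intersection, so the hull is one itself.\<close>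

lemma two_sided_ideal_ideal_R: "two_sided_ideal (ideal_R b p)"
  unfolding ideal_R_def by (rule hull_in) (unfold two_sided_ideal_def, blast)

lemma subspace_ideal_R: "tens.subspace (ideal_R b p)"
  using two_sided_ideal_ideal_R[of b p]
  by (auto simp: tens.subspace_def two_sided_ideal_def scale_eq_mult)

lemma sandwich_in_ideal_R: "u \<in> ideal_R b p \<Longrightarrow> x * u * y \<in> ideal_R b p"
  using two_sided_ideal_ideal_R[of b p] by (auto simp: two_sided_ideal_def)

lemma rel_in_ideal_R: "j < i \<Longrightarrow> rel b p i j \<in> ideal_R b p"
  unfolding ideal_R_def by (rule hull_inc) auto

section \<open>Swaps of letters and the inversion weight\<close>

text \<open>As in \<open>sigma_op\<close>, the position \<open>j\<close> is counted from 1, whereas lists are indexed from 0.\<close>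

definition swap_word :: "nat \<Rightarrow> 'n list \<Rightarrow> 'n list" where
  "swap_word j w = w[j - 1 := w ! j, j := w ! (j - 1)]"

lemma swap_word_split: "swap_word (Suc (length v)) (v @ [a, c] @ x) = v @ [c, a] @ x"
  by (simp add: swap_word_def nth_append list_update_append)

text \<open>Passes from a position to a factorization around the two letters concerned, the form in
  which relations and weights are computed.\<close>

lemma word_splitE:
  assumes "j \<in> {1..<length w}"
  obtains v a c x where "w = v @ [a, c] @ x" "j = Suc (length v)"
proof
  have "drop (j - 1) w = w ! (j - 1) # w ! j # drop (Suc j) w"
    using assms Cons_nth_drop_Suc[of "j - 1" w] Cons_nth_drop_Suc[of j w] by auto
  then show "w = take (j - 1) w @ [w ! (j - 1), w ! j] @ drop (Suc j) w"
    by (metis append_Cons append_Nil append_take_drop_id)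
  show "j = Suc (length (take (j - 1) w))"
    using assms by auto
qed

lemma length_swap_word [simp]: "length (swap_word j w) = length w"
  by (simp add: swap_word_def)

lemma count_list_swap_word:
  assumes "j \<in> {1..<length w}"
  shows "count_list (swap_word j w) = count_list w"
  using assms
proof (rule word_splitE)
  fix v a c x assume "w = v @ [a, c] @ x" "j = Suc (length v)"
  then show ?thesis
    by (auto simp: swap_word_split[unfolded append_Cons append_Nil])
qed

text \<open>The place permutation that moves the letter at position \<open>i\<close> to position
  \<open>\<sigma> i\<close>; the inverse makes it a left action, in line with products of
  transpositions. \<open>Suc\<close> and \<open>- 1\<close> translate between positions from 1 and
  list indices from 0.\<close>

definition permute_word :: "(nat \<Rightarrow> nat) \<Rightarrow> 'n list \<Rightarrow> 'n list" where
  "permute_word \<sigma> w = map (\<lambda>t. w ! (inv \<sigma> (Suc t) - 1)) [0..<length w]"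

lemma swap_word_permute_word:
  assumes "\<sigma> permutes {1..length w}" "j \<in> {1..<length w}"
  shows "swap_word j (permute_word \<sigma> w) = permute_word (Transposition.transpose j (j + 1) \<circ> \<sigma>) w"
proof (rule nth_equalityI)
  fix t assume "t < length (swap_word j (permute_word \<sigma> w))"
  then have t: "t < length w" by (simp add: permute_word_def)
  have "inv (Transposition.transpose j (j + 1) \<circ> \<sigma>) = inv \<sigma> \<circ> Transposition.transpose j (j + 1)"
    using assms permutes_bij[OF assms(1)] by (subst o_inv_distrib) auto
  then show "swap_word j (permute_word \<sigma> w) ! t
      = permute_word (Transposition.transpose j (j + 1) \<circ> \<sigma>) w ! t"
    using t assms(2)
    by (auto simp: permute_word_def swap_word_def nth_list_update Transposition.transpose_def)
qed (simp add: permute_word_def)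

lemma permute_word_swap_word:
  assumes "\<sigma> permutes {1..length w}" "j \<in> {1..<length w}"
  shows "permute_word \<sigma> (swap_word j w) = permute_word (\<sigma> \<circ> Transposition.transpose j (j + 1)) w"
proof (rule nth_equalityI)
  fix t assume "t < length (permute_word \<sigma> (swap_word j w))"
  then have t: "t < length w" by (simp add: permute_word_def)
  have inv: "inv (\<sigma> \<circ> Transposition.transpose j (j + 1)) = Transposition.transpose j (j + 1) \<circ> inv \<sigma>"
    using assms permutes_bij[OF assms(1)] by (subst o_inv_distrib) auto
  have "inv \<sigma> (Suc t) \<in> {1..length w}"
    using permutes_in_image[OF permutes_inv[OF assms(1)], of "Suc t"] t by auto
  then show "permute_word \<sigma> (swap_word j w) ! t
      = permute_word (\<sigma> \<circ> Transposition.transpose j (j + 1)) w ! t"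
    using t assms(2) inv
    by (auto simp: permute_word_def swap_word_def nth_list_update Transposition.transpose_def)
qed (simp add: permute_word_def)

section \<open>Products of elementary transpositions acting on words\<close>

definition transposition_product :: "nat list \<Rightarrow> nat \<Rightarrow> nat" where
  "transposition_product js = foldr (\<lambda>j f. Transposition.transpose j (j + 1) \<circ> f) js id"

lemma transposition_product_Nil: "transposition_product [] = id"
  and transposition_product_Cons:
    "transposition_product (j # js) = Transposition.transpose j (j + 1) \<circ> transposition_product js"
  by (simp_all add: transposition_product_def fun_eq_iff)

lemma transposition_product_permutes:
  assumes "set js \<subseteq> {1..<n}"
  shows "transposition_product js permutes {1..n}"
  using assms
  by (induction js) (auto intro!: permutes_compose permutes_swap_id
      simp: transposition_product_Nil transposition_product_Cons permutes_id simp del: One_nat_def)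

text \<open>The swaps along an expression compose to the place permutation of its product. Hence the
  resulting word depends on the permutation alone and not on the chosen expression.\<close>

lemma foldr_swap_word:
  assumes "set js \<subseteq> {1..<length w}"
  shows "foldr swap_word js w = permute_word (transposition_product js) w"
  using assms
proof (induction js)
  case Nil
  show ?case by (simp add: permute_word_def transposition_product_Nil map_nth)
next
  case (Cons j js)
  then have "foldr swap_word (j # js) w = swap_word j (permute_word (transposition_product js) w)"
    by simp
  also have "\<dots> = permute_word (Transposition.transpose j (j + 1) \<circ> transposition_product js) w"
    using Cons.prems by (intro swap_word_permute_word transposition_product_permutes) simp_all
  finally show ?case by (simp only: transposition_product_Cons)
qed

text \<open>The product of \<open>b x y\<close> over all inversions, that is, over all pairs of
  positions with \<open>x\<close> before \<open>y\<close> and \<open>y < x\<close>.\<close>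

primrec inversion_weight :: "('n::linorder \<Rightarrow> 'n \<Rightarrow> complex) \<Rightarrow> 'n list \<Rightarrow> complex" where
  "inversion_weight b [] = 1"
| "inversion_weight b (x # w) = (\<Prod>y\<leftarrow>w. if y < x then b x y else 1) * inversion_weight b w"

text \<open>Exchanging neighbours alters the relative order of that one pair only.\<close>

lemma inversion_weight_swap:
  "j < i \<Longrightarrow> inversion_weight b (v @ [i, j] @ w) = b i j * inversion_weight b (v @ [j, i] @ w)"
  by (induction v) (auto simp: algebra_simps)

section \<open>Leading terms of the operators\<close>

locale quadratic_relations =
  fixes b :: "'n::{finite,linorder} \<Rightarrow> 'n \<Rightarrow> complex" and p :: "'n \<Rightarrow> 'n \<Rightarrow> 'n tens"
  assumes b_nonzero: "j < i \<Longrightarrow> b i j \<noteq> 0"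
    and p_span: "j < i \<Longrightarrow> p i j \<in> tens.span {monomial [a, c] | a c. a < i \<and> c < i}"
begin

lemma inversion_weight_nonzero: "inversion_weight b w \<noteq> 0"
  by (induction w) (auto simp: prod_list_zero_iff b_nonzero split: if_splits)

text \<open>Both letters that replace \<open>i\<close> and \<open>j\<close> are smaller than
  \<open>i\<close>: the count of \<open>i\<close> drops by one and the counts of larger letters stay
  the same.\<close>

lemma p_lower:
  assumes "j < i"
  shows "monomial v * p i j * monomial x
    \<in> lower (length (v @ [i, j] @ x)) (count_list (v @ [i, j] @ x))"
proof (rule linear_span_image[OF linear_sandwich subspace_lower p_span[OF assms]])
  fix g assume "g \<in> {monomial [a, c] | a c. a < i \<and> c < i}"
  then obtain a c where g: "g = monomial [a, c]" "a < i" "c < i" by auto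
  have "lex_less (count_list (v @ [a, c] @ x)) (count_list (v @ [i, j] @ x))"
    unfolding lex_less_def using g assms by (intro exI[of _ i]) auto
  then show "monomial v * g * monomial x
      \<in> lower (length (v @ [i, j] @ x)) (count_list (v @ [i, j] @ x))"
    by (simp add: g monomial_mult lower_def monomial_in_words_span)
qed

lemma linear_sigma_op: "Vector_Spaces.linear scale scale (sigma_op b p j)"
  unfolding sigma_op_def by (rule linear_id_tensor)

lemma sigma_op_monomial:
  "sigma_op b p (Suc (length v)) (monomial (v @ [a, c] @ x))
    = monomial v * S_word b p a c * monomial x"
  unfolding sigma_op_def S_op_def
  by (subst id_tensor_monomial) (simp_all add: lin_ext_monomial)

text \<open>The scalar in \<open>S_word\<close> is exactly the quotient of the two weights, and the
  remainder comes from \<open>p\<close>. So on words divided by their weight,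
  \<open>sigma_op\<close> is a plain swap up to smaller order.\<close>

lemma sigma_op_leading:
  assumes "j \<in> {1..<length w}"
  shows "sigma_op b p j (monomial w)
      - scale (inversion_weight b w / inversion_weight b (swap_word j w)) (monomial (swap_word j w))
    \<in> lower (length w) (count_list w)"
  using assms
proof (rule word_splitE)
  fix v a c x assume w: "w = v @ [a, c] @ x" and j: "j = Suc (length v)"
  have sw: "swap_word j w = v @ [c, a] @ x"
    by (simp only: w j swap_word_split)
  consider "c < a" | "a < c" | "a = c" by fastforce
  then show ?thesis
  proof cases
    case 1
    then have "inversion_weight b w / inversion_weight b (swap_word j w) = b a c"
      using inversion_weight_swap[OF 1, of b v x] inversion_weight_nonzero[of "v @ [c, a] @ x"]
      unfolding sw unfolding w by simp
    then have "sigma_op b p j (monomial w)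
        - scale (inversion_weight b w / inversion_weight b (swap_word j w)) (monomial (swap_word j w))
      = monomial v * p a c * monomial x"
      unfolding sw unfolding w j sigma_op_monomial using 1
      by (simp add: S_word_def distrib_left distrib_right scale_mult_left scale_mult_right monomial_mult)
    then show ?thesis
      using p_lower[OF 1, of v x] by (simp add: w)
  next
    case 2
    then have "\<not> c < a" by simp
    have "inversion_weight b w / inversion_weight b (swap_word j w) = inverse (b c a)"
      using inversion_weight_swap[OF 2, of b v x] inversion_weight_nonzero[of "v @ [a, c] @ x"] b_nonzero[OF 2]
      unfolding sw unfolding w by (simp add: field_simps)
    then have "sigma_op b p j (monomial w)
        - scale (inversion_weight b w / inversion_weight b (swap_word j w)) (monomial (swap_word j w))
      = scale (- inverse (b c a)) (monomial v * p c a * monomial x)"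
      unfolding sw unfolding w j sigma_op_monomial using \<open>\<not> c < a\<close> 2
      by (simp add: S_word_def left_diff_distrib right_diff_distrib scale_mult_left scale_mult_right
          monomial_mult tens.scale_right_diff_distrib)
    \<comment> \<open>\<open>p_lower\<close> compares with the word having the larger letter first,
      which is the swapped word here; its multidegree is the same.\<close>
    moreover have "count_list (v @ [c, a] @ x) = count_list w"
      by (auto simp: w)
    ultimately show ?thesis
      using p_lower[OF 2, of v x] by (simp add: w tens.subspace_scale[OF subspace_lower]
          tens.subspace_neg[OF subspace_lower])
  next
    case 3
    then have "sigma_op b p j (monomial w) = monomial w" "swap_word j w = w"
      unfolding sw unfolding w j sigma_op_monomial by (simp_all add: S_word_def monomial_mult)
    then show ?thesis
      using inversion_weight_nonzero[of w] tens.subspace_0[OF subspace_lower] by simp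
  qed
qed

lemma sigma_op_lower:
  assumes "u \<in> lower n m" "j \<in> {1..<n}"
  shows "sigma_op b p j u \<in> lower n m"
  using assms(1) unfolding lower_def[of n m]
proof (rule linear_words_span_image[OF linear_sigma_op subspace_words_span])
  fix w assume "w \<in> {w. length w = n \<and> lex_less (count_list w) m}"
  then have w: "length w = n" "lex_less (count_list w) m" by auto
  let ?u = "scale (inversion_weight b w / inversion_weight b (swap_word j w)) (monomial (swap_word j w))"
  have "monomial (swap_word j w) \<in> lower n m"
    using w assms(2) by (simp add: lower_def monomial_in_words_span count_list_swap_word)
  then have "?u \<in> lower n m"
    by (rule tens.subspace_scale[OF subspace_lower])
  moreover have "sigma_op b p j (monomial w) - ?u \<in> lower n m"
    using sigma_op_leading[of j w] w assms(2) lower_mono[of "count_list w" m n]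
    by (auto simp: lex_le_iff)
  ultimately have "sigma_op b p j (monomial w) - ?u + ?u \<in> lower n m"
    by (rule tens.subspace_add[OF subspace_lower, rotated])
  then show "sigma_op b p j (monomial w) \<in> words_span {w. length w = n \<and> lex_less (count_list w) m}"
    by (simp add: lower_def)
qed

section \<open>Products of the elementary operators along an expression\<close>

lemma hat_op_Nil: "hat_op b p [] = id"
  and hat_op_Cons: "hat_op b p (j # js) = sigma_op b p j \<circ> hat_op b p js"
  by (simp_all add: hat_op_def fun_eq_iff)

lemma linear_hat_op: "Vector_Spaces.linear scale scale (hat_op b p js)"
proof (induction js)
  case Nil
  show ?case by (simp only: hat_op_Nil tens.linear_id)
next
  case (Cons j js)
  then show ?case
    by (simp only: hat_op_Cons Vector_Spaces.linear_compose linear_sigma_op)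
qed

lemma hat_op_lower: "u \<in> lower n m \<Longrightarrow> set js \<subseteq> {1..<n} \<Longrightarrow> hat_op b p js u \<in> lower n m"
  by (induction js) (auto simp: hat_op_Cons sigma_op_lower, simp add: hat_op_def)

text \<open>The quotients of weights telescope along the expression, leaving only the weights of the
  first and last words. Remainders from earlier factors stay lower by
  \<open>sigma_op_lower\<close>.\<close>

lemma hat_op_leading:
  assumes "set js \<subseteq> {1..<length w}"
  shows "length (foldr swap_word js w) = length w \<and> count_list (foldr swap_word js w) = count_list w \<and>
    hat_op b p js (monomial w)
      - scale (inversion_weight b w / inversion_weight b (foldr swap_word js w))
        (monomial (foldr swap_word js w))
    \<in> lower (length w) (count_list w)"
  using assms
proof (induction js)
  case Nil
  show ?case
    using inversion_weight_nonzero[of w] tens.subspace_0[OF subspace_lower] by (simp add: hat_op_def)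
next
  case (Cons j js)
  define w' where "w' = foldr swap_word js w"
  define d where "d = hat_op b p js (monomial w)
    - scale (inversion_weight b w / inversion_weight b w') (monomial w')"
  define d' where "d' = sigma_op b p j (monomial w')
    - scale (inversion_weight b w' / inversion_weight b (swap_word j w')) (monomial (swap_word j w'))"
  have w': "length w' = length w" "count_list w' = count_list w"
    and d: "d \<in> lower (length w) (count_list w)"
    using Cons by (simp_all add: w'_def d_def)
  have j: "j \<in> {1..<length w}" using Cons.prems by simp
  have "d' \<in> lower (length w) (count_list w)"
    using sigma_op_leading[of j w'] w' j by (simp add: d'_def)
  moreover have "sigma_op b p j d \<in> lower (length w) (count_list w)"
    using d j by (rule sigma_op_lower)
  moreover have "hat_op b p (j # js) (monomial w)
      - scale (inversion_weight b w / inversion_weight b (swap_word j w')) (monomial (swap_word j w'))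
    = sigma_op b p j d + scale (inversion_weight b w / inversion_weight b w') d'"
    using inversion_weight_nonzero[of w']
    by (simp add: d_def d'_def hat_op_Cons tens_pair.linear_diff[OF linear_sigma_op]
        tens_pair.linear_scale[OF linear_sigma_op] tens.scale_right_diff_distrib)
  ultimately show ?case
    using w' j count_list_swap_word[of j w']
    by (simp add: w'_def[symmetric] tens.subspace_add[OF subspace_lower] tens.subspace_scale[OF subspace_lower])
qed

section \<open>The averaged operator and the symmetrizer\<close>

lemma linear_P_op: "Vector_Spaces.linear scale scale (P_op b p e n)"
  unfolding P_op_def[abs_def]
  by (intro tens_pair.linear_compose_scale_right tens_pair.linear_compose_sum ballI linear_hat_op)

text \<open>The unnormalized symmetrizer in the basis of words divided by their weight. The sum runs
  over permutations, so with repeated letters the same word occurs several times.\<close>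

definition symmetrized :: "'n list \<Rightarrow> 'n tens" where
  "symmetrized w = (\<Sum>\<sigma> | \<sigma> permutes {1..length w}.
    scale (1 / inversion_weight b (permute_word \<sigma> w)) (monomial (permute_word \<sigma> w)))"

text \<open>Right multiplication by a transposition is a bijection of the symmetric group, so it
  only reindexes the sum.\<close>

lemma symmetrized_swap_word:
  assumes "j \<in> {1..<length w}"
  shows "symmetrized (swap_word j w) = symmetrized w"
proof -
  let ?s = "Transposition.transpose j (j + 1)"
  let ?f = "\<lambda>\<sigma>. scale (1 / inversion_weight b (permute_word \<sigma> w)) (monomial (permute_word \<sigma> w))"
  have s: "?s permutes {1..length w}"
    using assms by (intro permutes_swap_id) auto
  have "symmetrized (swap_word j w) = (\<Sum>\<sigma> | \<sigma> permutes {1..length w}. ?f (\<sigma> \<circ> ?s))"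
    unfolding symmetrized_def using assms by (intro sum.cong) (simp_all add: permute_word_swap_word)
  also have "\<dots> = symmetrized w"
    unfolding symmetrized_def by (rule sum_permutations_compose_right[OF s, symmetric])
  finally show ?thesis .
qed

end

section \<open>The symmetrizer and the ideal\<close>

locale quadratic_relations_expressions = quadratic_relations b p
  for b :: "'n::{finite,linorder} \<Rightarrow> 'n \<Rightarrow> complex" and p +
  fixes e :: "nat \<Rightarrow> (nat \<Rightarrow> nat) \<Rightarrow> nat list"
  assumes choice: "expression_choice e"
begin

section \<open>Leading terms of the averaged operator\<close>

lemma expression_choiceD:
  assumes "\<sigma> permutes {1..n}"
  shows "set (e n \<sigma>) \<subseteq> {1..<n}" "transposition_product (e n \<sigma>) = \<sigma>"
  using choice assms unfolding expression_choice_def transposition_product_def by blast+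

lemma P_op_lower: "u \<in> lower n m \<Longrightarrow> P_op b p e n u \<in> lower n m"
  unfolding P_op_def
  by (intro tens.subspace_scale tens.subspace_sum subspace_lower hat_op_lower)
    (use expression_choiceD in blast)+

text \<open>Averages \<open>hat_op_leading\<close> over all permutations; by
  \<open>foldr_swap_word\<close> the leading word for \<open>\<sigma>\<close> is
  \<open>permute_word \<sigma> w\<close>, whatever the expression.\<close>

lemma P_op_leading:
  assumes "length w = n"
  shows "P_op b p e n (monomial w) - scale (inversion_weight b w / fact n) (symmetrized w)
    \<in> lower n (count_list w)"
proof -
  let ?d = "\<lambda>\<sigma>. hat_op b p (e n \<sigma>) (monomial w)
    - scale (inversion_weight b w / inversion_weight b (permute_word \<sigma> w)) (monomial (permute_word \<sigma> w))"
  have "?d \<sigma> \<in> lower n (count_list w)" if "\<sigma> permutes {1..n}" for \<sigma>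
    using hat_op_leading[of "e n \<sigma>" w] expression_choiceD[OF that] foldr_swap_word[of "e n \<sigma>" w] assms
    by simp
  then have "scale (1 / fact n) (\<Sum>\<sigma> | \<sigma> permutes {1..n}. ?d \<sigma>) \<in> lower n (count_list w)"
    by (intro tens.subspace_scale tens.subspace_sum subspace_lower) auto
  moreover have "scale (1 / fact n) (\<Sum>\<sigma> | \<sigma> permutes {1..n}. ?d \<sigma>)
      = P_op b p e n (monomial w) - scale (inversion_weight b w / fact n) (symmetrized w)"
    using assms by (simp add: P_op_def symmetrized_def sum_subtractf tens.scale_right_diff_distrib
        tens.scale_sum_right)
  ultimately show ?thesis by simp
qed

text \<open>The words of the relation have equal symmetrizations, and their weights differ by the
  factor \<open>b i j\<close>, so their leading parts cancel. The \<open>p\<close> term is lower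
  from the start, and \<open>P_op\<close> keeps it so.\<close>

lemma P_op_rel_lower:
  assumes "j < i" "length (v @ [i, j] @ x) = n"
  shows "P_op b p e n (monomial v * rel b p i j * monomial x)
    \<in> lower n (count_list (v @ [i, j] @ x))"
proof -
  define w w' where w: "w = v @ [i, j] @ x" and w': "w' = v @ [j, i] @ x"
  define d where "d u = P_op b p e n (monomial u) - scale (inversion_weight b u / fact n) (symmetrized w)"
    for u
  have sw: "w' = swap_word (Suc (length v)) w"
    by (simp only: w w' swap_word_split)
  have c: "count_list w' = count_list w" and l: "length w = n" "length w' = n"
    using assms by (auto simp: w w')
  have "symmetrized w' = symmetrized w"
    unfolding sw by (rule symmetrized_swap_word) (simp add: w)
  then have "d w \<in> lower n (count_list w)" "d w' \<in> lower n (count_list w)"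
    using P_op_leading[OF l(1)] P_op_leading[OF l(2)] c by (simp_all add: d_def)
  moreover have "P_op b p e n (monomial v * p i j * monomial x) \<in> lower n (count_list w)"
    using p_lower[OF assms(1), of v x] l by (intro P_op_lower) (simp add: w)
  moreover have "monomial v * rel b p i j * monomial x
      = monomial w - scale (b i j) (monomial w') - monomial v * p i j * monomial x"
    by (simp add: rel_def w w' left_diff_distrib right_diff_distrib monomial_mult scale_mult_left
        scale_mult_right)
  then have "P_op b p e n (monomial v * rel b p i j * monomial x)
      = d w - scale (b i j) (d w') - P_op b p e n (monomial v * p i j * monomial x)"
    using inversion_weight_swap[OF assms(1), of b v x]
    by (simp add: d_def tens_pair.linear_diff[OF linear_P_op] tens_pair.linear_scale[OF linear_P_op]
        tens.scale_right_diff_distrib) (simp add: w w')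
  ultimately show ?thesis
    unfolding w[symmetric]
    by (simp add: tens.subspace_diff[OF subspace_lower] tens.subspace_scale[OF subspace_lower])
qed

section \<open>The operators modulo the ideal\<close>

abbreviation ideal_part :: "nat \<Rightarrow> 'n tens set" where
  "ideal_part n \<equiv> ideal_R b p \<inter> Tn n"

lemma subspace_ideal_part: "tens.subspace (ideal_part n)"
  by (intro tens.subspace_inter subspace_ideal_R) (simp add: Tn_eq_words_span subspace_words_span)

lemma sigma_op_monomial_in_Tn:
  assumes "j \<in> {1..<length w}"
  shows "sigma_op b p j (monomial w) \<in> Tn (length w)"
proof -
  let ?u = "scale (inversion_weight b w / inversion_weight b (swap_word j w)) (monomial (swap_word j w))"
  have "sigma_op b p j (monomial w) - ?u \<in> Tn (length w)"
    using sigma_op_leading[OF assms] lower_subset_Tn by blast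
  moreover have "?u \<in> Tn (length w)"
    by (intro tens.subspace_scale subspace_Tn) (simp add: monomial_in_Tn)
  ultimately have "sigma_op b p j (monomial w) - ?u + ?u \<in> Tn (length w)"
    by (rule tens.subspace_add[OF subspace_Tn])
  then show ?thesis by simp
qed

text \<open>The difference is a multiple of a relation placed between two monomials, with factor -1
  for a descent and the inverse of \<open>b c a\<close> for an ascent. It vanishes for equal
  letters.\<close>

lemma sigma_op_monomial_diff_ideal:
  assumes "j \<in> {1..<length w}"
  shows "sigma_op b p j (monomial w) - monomial w \<in> ideal_R b p"
  using assms
proof (rule word_splitE)
  fix v a c x assume w: "w = v @ [a, c] @ x" and j: "j = Suc (length v)"
  consider "c < a" | "a < c" | "a = c" by fastforce
  then show ?thesis
  proof cases
    case 1
    then have "sigma_op b p j (monomial w) - monomial w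
        = - (monomial v * rel b p a c * monomial x)"
      unfolding w j sigma_op_monomial
      by (simp add: S_word_def rel_def left_diff_distrib right_diff_distrib distrib_left distrib_right
          monomial_mult)
    then show ?thesis
      using tens.subspace_neg[OF subspace_ideal_R sandwich_in_ideal_R[OF rel_in_ideal_R[OF 1]]] by simp
  next
    case 2
    then have "\<not> c < a" by simp
    with 2 have "sigma_op b p j (monomial w) - monomial w
        = scale (inverse (b c a)) (monomial v * rel b p c a * monomial x)"
      unfolding w j sigma_op_monomial using b_nonzero[OF 2] \<open>\<not> c < a\<close>
      by (simp add: S_word_def rel_def left_diff_distrib right_diff_distrib monomial_mult
          scale_mult_left scale_mult_right tens.scale_right_diff_distrib)
    then show ?thesis
      using tens.subspace_scale[OF subspace_ideal_R sandwich_in_ideal_R[OF rel_in_ideal_R[OF 2]]] by simp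
  next
    case 3
    then show ?thesis
      unfolding w j sigma_op_monomial
      using tens.subspace_0[OF subspace_ideal_R] by (simp add: S_word_def monomial_mult)
  qed
qed

lemma sigma_op_diff_ideal:
  assumes "u \<in> Tn n" "j \<in> {1..<n}"
  shows "sigma_op b p j u - u \<in> ideal_part n"
proof -
  have "Vector_Spaces.linear scale scale (\<lambda>u. sigma_op b p j u - u)"
    using tens_pair.linear_compose_sub[OF linear_sigma_op tens.linear_ident] .
  then show ?thesis
  proof (rule linear_words_span_image[OF _ subspace_ideal_part])
    show "u \<in> words_span {w. length w = n}"
      using assms(1) by (simp add: Tn_eq_words_span)
    fix w :: "'n list" assume "w \<in> {w. length w = n}"
    then show "sigma_op b p j (monomial w) - monomial w \<in> ideal_part n"
      using assms(2) sigma_op_monomial_diff_ideal[of j w] sigma_op_monomial_in_Tn[of j w]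
      by (auto intro!: tens.subspace_diff[OF subspace_Tn] simp: monomial_in_Tn)
  qed
qed

lemma hat_op_diff_ideal:
  assumes "u \<in> Tn n" "set js \<subseteq> {1..<n}"
  shows "hat_op b p js u - u \<in> ideal_part n"
  using assms(2)
proof (induction js)
  case Nil
  show ?case using tens.subspace_0[OF subspace_ideal_part] by (simp add: hat_op_def)
next
  case (Cons j js)
  let ?v = "hat_op b p js u"
  have d: "?v - u \<in> ideal_part n" using Cons by simp
  then have "?v - u + u \<in> Tn n"
    using assms(1) by (intro tens.subspace_add[OF subspace_Tn]) auto
  then have "sigma_op b p j ?v - ?v \<in> ideal_part n"
    using Cons.prems by (intro sigma_op_diff_ideal) auto
  then have "(sigma_op b p j ?v - ?v) + (?v - u) \<in> ideal_part n"
    using d by (rule tens.subspace_add[OF subspace_ideal_part])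
  then show ?case by (simp add: hat_op_Cons)
qed

lemma P_op_diff_ideal:
  assumes "u \<in> Tn n"
  shows "P_op b p e n u - u \<in> ideal_part n"
proof -
  have "scale (1 / fact n) (\<Sum>\<sigma> | \<sigma> permutes {1..n}. hat_op b p (e n \<sigma>) u - u) \<in> ideal_part n"
    using assms expression_choiceD
    by (intro tens.subspace_scale tens.subspace_sum subspace_ideal_part hat_op_diff_ideal) auto
  \<comment> \<open>There are n! summands, so the normalization recovers \<open>u\<close>
    exactly.\<close>
  moreover have "(\<Sum>\<sigma> | \<sigma> permutes {1..n}. u) = scale (fact n) u"
  proof -
    have "(\<Sum>\<sigma> | \<sigma> permutes {1..n}. scale 1 u) = scale (\<Sum>\<sigma> | \<sigma> permutes {1..n}. 1) u"
      by (rule tens.scale_sum_left[symmetric])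
    then show ?thesis by (simp add: card_permutations[of _ n])
  qed
  ultimately show ?thesis
    by (simp add: P_op_def sum_subtractf tens.scale_right_diff_distrib)
qed

lemma P_op_in_ideal_part:
  assumes "u \<in> ideal_part n"
  shows "P_op b p e n u \<in> ideal_part n"
proof -
  have "P_op b p e n u - u + u \<in> ideal_part n"
    using assms P_op_diff_ideal[of u n] by (intro tens.subspace_add[OF subspace_ideal_part]) auto
  then show ?thesis by simp
qed

lemma P_op_funpow_diff_ideal:
  assumes "u \<in> Tn n"
  shows "(P_op b p e n ^^ M) u - u \<in> ideal_part n"
proof (induction M)
  case 0
  show ?case using tens.subspace_0[OF subspace_ideal_part] by simp
next
  case (Suc M)
  let ?v = "(P_op b p e n ^^ M) u"
  have "?v - u + u \<in> Tn n"
    using Suc assms by (intro tens.subspace_add[OF subspace_Tn]) auto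
  then have "(P_op b p e n ?v - ?v) + (?v - u) \<in> ideal_part n"
    using Suc by (intro tens.subspace_add[OF subspace_ideal_part] P_op_diff_ideal) auto
  then show ?case by simp
qed

lemma linear_P_op_funpow: "Vector_Spaces.linear scale scale (P_op b p e n ^^ M)"
proof (induction M)
  case 0
  show ?case by (simp only: funpow.simps tens.linear_id)
next
  case (Suc M)
  then show ?case
    by (simp only: funpow.simps Vector_Spaces.linear_compose linear_P_op)
qed

section \<open>Nilpotency on the ideal and the limit under (EA)\<close>

context
  assumes EA: "EA b p"
begin

text \<open>(EA) expresses \<open>u\<close> through relations whose leading words do not exceed the
  order of \<open>u\<close>, so \<open>P_op_rel_lower\<close> applies to each term.\<close>

lemma P_op_decreases_order:
  assumes "u \<in> ideal_part n" "u \<noteq> 0"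
  shows "P_op b p e n u \<in> lower n (tord u)"
proof (rule linear_span_image[OF linear_P_op subspace_lower])
  show "u \<in> tens.span {monomial v * rel b p i j * monomial w | v w i j.
      j < i \<and> length (v @ [i, j] @ w) = n \<and> lex_le (count_list (v @ [i, j] @ w)) (tord u)}"
    using EA assms unfolding EA_def by blast
  fix g assume "g \<in> {monomial v * rel b p i j * monomial w | v w i j.
      j < i \<and> length (v @ [i, j] @ w) = n \<and> lex_le (count_list (v @ [i, j] @ w)) (tord u)}"
  then obtain v w i j where g: "g = monomial v * rel b p i j * monomial w" "j < i"
    "length (v @ [i, j] @ w) = n" "lex_le (count_list (v @ [i, j] @ w)) (tord u)" by blast
  show "P_op b p e n g \<in> lower n (tord u)"
    using P_op_rel_lower[OF g(2,3)] lower_mono[OF g(4), of n] unfolding g(1) by blast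
qed

text \<open>Induction on the number of words of length \<open>n\<close> strictly below the order of
  \<open>u\<close>, which is finite since the alphabet is.\<close>

lemma P_op_nilpotent_on_ideal:
  assumes "u \<in> ideal_part n"
  shows "\<exists>M. (P_op b p e n ^^ M) u = 0"
  using assms
proof (induction "card {w. length w = n \<and> lex_less (count_list w) (tord u)}"
    arbitrary: u rule: less_induct)
  case less
  let ?v = "P_op b p e n u"
  let ?W = "\<lambda>u. {w. length w = n \<and> lex_less (count_list w) (tord u)}"
  have fin: "finite (?W u)" for u
    by (rule finite_subset[OF _ finite_lists_length_eq[of UNIV n]]) auto
  consider "u = 0" | "?v = 0" | "u \<noteq> 0" "?v \<noteq> 0" by blast
  then show ?case
  proof cases
    case 1
    then show ?thesis by (intro exI[of _ 0]) simp
  next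
    case 2
    then show ?thesis by (intro exI[of _ 1]) simp
  next
    case 3
    obtain w where w: "w \<in> Poly_Mapping.keys ?v" "tord ?v = count_list w"
      using tord_props(1)[OF 3(2)] by auto
    \<comment> \<open>A word that attains the order of \<open>?v\<close> lies below the order of
      \<open>u\<close> but not below its own; this makes the inclusion of the two sets
      strict.\<close>
    have "w \<in> ?W u"
      using P_op_decreases_order[OF less.prems 3(1)] w(1) by (auto simp: lower_def words_span_def)
    moreover have "w \<notin> ?W ?v"
      by (simp add: w(2) lex_less_irrefl)
    moreover have "?W ?v \<subseteq> ?W u"
      using \<open>w \<in> ?W u\<close> w(2) lex_less_trans by fastforce
    ultimately have "card (?W ?v) < card (?W u)"
      using fin by (intro psubset_card_mono) auto
    from less.hyps[OF this P_op_in_ideal_part[OF less.prems]]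
    obtain M where "(P_op b p e n ^^ M) ?v = 0" by blast
    then show ?thesis
      by (intro exI[of _ "Suc M"]) (simp add: funpow_swap1)
  qed
qed

text \<open>Once some power kills the difference, all higher powers do.\<close>

lemma P_op_funpow_eventually_eq:
  assumes "x - y \<in> ideal_part n"
  shows "\<exists>M0. \<forall>M\<ge>M0. (P_op b p e n ^^ M) x = (P_op b p e n ^^ M) y"
proof -
  obtain M0 where M0: "(P_op b p e n ^^ M0) (x - y) = 0"
    using P_op_nilpotent_on_ideal[OF assms] by blast
  have "(P_op b p e n ^^ M) x = (P_op b p e n ^^ M) y" if "M \<ge> M0" for M
  proof -
    have "(P_op b p e n ^^ M) (x - y) = (P_op b p e n ^^ (M - M0)) ((P_op b p e n ^^ M0) (x - y))"
      using that funpow_add[of "M - M0" M0 "P_op b p e n"] by simp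
    also have "\<dots> = 0"
      using M0 tens_pair.linear_0[OF linear_P_op_funpow] by simp
    finally show ?thesis
      by (simp add: tens_pair.linear_diff[OF linear_P_op_funpow])
  qed
  then show ?thesis by blast
qed

text \<open>An eventually constant sequence converges to its final value in every coefficient, and
  limits of coefficients are unique.\<close>

lemma P_qsym_eqI:
  assumes "\<And>M. M \<ge> M0 \<Longrightarrow> (P_op b p e n ^^ M) u = v"
  shows "P_qsym b p e n u = v"
  unfolding P_qsym_def
proof (rule the_equality)
  have lim: "(\<lambda>M. Poly_Mapping.lookup ((P_op b p e n ^^ M) u) w) \<longlonglongrightarrow> Poly_Mapping.lookup v w" for w
    by (rule tendsto_eventually) (use assms in \<open>auto simp: eventually_sequentially\<close>)
  then show "\<forall>w. (\<lambda>M. Poly_Mapping.lookup ((P_op b p e n ^^ M) u) w) \<longlonglongrightarrow> Poly_Mapping.lookup v w"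
    by blast
  fix v' assume "\<forall>w. (\<lambda>M. Poly_Mapping.lookup ((P_op b p e n ^^ M) u) w) \<longlonglongrightarrow> Poly_Mapping.lookup v' w"
  then show "v' = v"
    using lim by (intro poly_mapping_eqI) (blast intro: LIMSEQ_unique)
qed

lemma P_op_funpow_eventually_P_qsym:
  assumes "u \<in> Tn n"
  shows "\<exists>M0. \<forall>M\<ge>M0. (P_op b p e n ^^ M) u = P_qsym b p e n u"
proof -
  \<comment> \<open>\<open>u\<close> and its image under \<open>P_op\<close> are congruent, so large
    powers agree on them. Hence consecutive powers applied to \<open>u\<close> eventually
    coincide.\<close>
  obtain M0 where M0: "\<And>M. M \<ge> M0 \<Longrightarrow> (P_op b p e n ^^ M) (P_op b p e n u) = (P_op b p e n ^^ M) u"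
    using P_op_funpow_eventually_eq[OF P_op_diff_ideal[OF assms]] by blast
  have "(P_op b p e n ^^ M) u = (P_op b p e n ^^ M0) u" if "M \<ge> M0" for M
    using that
  proof (induction M rule: dec_induct)
    case (step M)
    have "(P_op b p e n ^^ Suc M) u = (P_op b p e n ^^ M) (P_op b p e n u)"
      by (simp add: funpow_swap1)
    then show ?case using M0 step by simp
  qed simp
  then show ?thesis using P_qsym_eqI by metis
qed

text \<open>The limit is attained by a power of \<open>P_op\<close>, and every power fixes classes
  modulo the ideal.\<close>

lemma P_qsym_diff_ideal:
  assumes "u \<in> Tn n"
  shows "P_qsym b p e n u - u \<in> ideal_part n"
  using P_op_funpow_eventually_P_qsym[OF assms] P_op_funpow_diff_ideal[OF assms] by (metis order_refl)

lemma P_qsym_cong_ideal: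
  assumes "y \<in> Tn n" "x - y \<in> ideal_part n"
  shows "P_qsym b p e n x = P_qsym b p e n y"
proof -
  obtain M0 M1 where "\<And>M. M \<ge> M0 \<Longrightarrow> (P_op b p e n ^^ M) x = (P_op b p e n ^^ M) y"
    "\<And>M. M \<ge> M1 \<Longrightarrow> (P_op b p e n ^^ M) y = P_qsym b p e n y"
    using P_op_funpow_eventually_eq[OF assms(2)] P_op_funpow_eventually_P_qsym[OF assms(1)] by blast
  then show ?thesis by (intro P_qsym_eqI[of "max M0 M1"]) simp
qed

text \<open>On a word the operator changes only the middle factor, by an element of the ideal;
  multiplying by the outer factors stays in the ideal.\<close>

lemma id_tensor_P_qsym_diff_ideal:
  assumes "u \<in> Tn (r + k + s)"
  shows "id_tensor r k (P_qsym b p e k) u - u \<in> ideal_part (r + k + s)"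
proof -
  have "Vector_Spaces.linear scale scale (\<lambda>u. id_tensor r k (P_qsym b p e k) u - u)"
    using tens_pair.linear_compose_sub[OF linear_id_tensor tens.linear_ident] .
  then show ?thesis
  proof (rule linear_words_span_image[OF _ subspace_ideal_part])
    show "u \<in> words_span {w. length w = r + k + s}"
      using assms by (simp add: Tn_eq_words_span)
    fix w :: "'n list" assume "w \<in> {w. length w = r + k + s}"
    then obtain v y x where w: "w = v @ y @ x" "length v = r" "length y = k" "length x = s"
      by (intro that[of "take r w" "take k (drop r w)" "drop (r + k) w"])
        (auto simp: append_take_drop_id add.commute simp flip: drop_drop)
    let ?d = "P_qsym b p e k (monomial y) - monomial y"
    have d: "?d \<in> ideal_part k"
      using w by (intro P_qsym_diff_ideal) (simp add: monomial_in_Tn)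
    have eq: "id_tensor r k (P_qsym b p e k) (monomial w) - monomial w = monomial v * ?d * monomial x"
      using w by (simp add: id_tensor_monomial left_diff_distrib right_diff_distrib monomial_mult)
    have "monomial v * ?d * monomial x \<in> Tn (r + k + s)"
      using d w by (intro linear_words_span_image[OF linear_sandwich subspace_Tn, of ?d "{w. length w = k}"])
        (auto simp: monomial_mult monomial_in_Tn simp flip: Tn_eq_words_span)
    with d show "id_tensor r k (P_qsym b p e k) (monomial w) - monomial w \<in> ideal_part (r + k + s)"
      unfolding eq using sandwich_in_ideal_R by blast
  qed
qed

end

end

theorem proposition5p19:
  fixes q :: complex
    and \<alpha> :: "'n::{finite,linorder} \<Rightarrow> 'n \<Rightarrow> complex"
    and b :: "'n \<Rightarrow> 'n \<Rightarrow> complex"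
    and p :: "'n \<Rightarrow> 'n \<Rightarrow> 'n tens"
    and e :: "nat \<Rightarrow> (nat \<Rightarrow> nat) \<Rightarrow> nat list"
    and r s k :: nat
  assumes "q \<noteq> 0"
    and "\<And>i j. j < i \<Longrightarrow> b i j = q powr \<alpha> i j"
    and "\<And>i j. j < i \<Longrightarrow> p i j \<in> tens.span {monomial [a, c] | a c. a < i \<and> c < i}"
    and "EA b p"
    and "expression_choice e"
    and "k \<ge> 1"
  shows "\<forall>u \<in> Tn (r + k + s).
    P_qsym b p e (r + k + s) (id_tensor r k (P_qsym b p e k) u) = P_qsym b p e (r + k + s) u"
proof -
  interpret quadratic_relations_expressions b p e
    \<comment> \<open>Complex powers of the nonzero \<open>q\<close> are values of the exponential
      and hence nonzero, which gives \<open>b_nonzero\<close>.\<close>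
    using assms by unfold_locales (auto simp: powr_def)
  show ?thesis
    \<comment> \<open>Both arguments of the outer operator lie in one class modulo the ideal, and
      the limit depends on the class only.\<close>
    using P_qsym_cong_ideal id_tensor_P_qsym_diff_ideal assms(4) by blast
qed

end
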